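(* There does not exist any $\epsilon>0$ such that, for every $n\ge 1$ and every quadratic form $f\in\mathcal{H}_{n,2}$, $$f_{\Delta(n,r)}-\underline{f}\le\frac{1}{r^{1+\epsilon}}\left(\overline{f}-\underline{f}\right)\quad\text{for all integers } r\ge1.$$
   Context: $\mathbb{N}=\{0,1,2,\dots\}$. $\mathcal{H}_{n,d}$ is the set of homogeneous polynomials of degree $d$ in $n$ variables with real coefficients. The standard simplex is $\Delta_n=\{x\in\mathbb{R}_+^n:\sum_{i=1}^n x_i=1\}$; $\underline{f}=\min_{x\in\Delta_n}f(x)$ and $\overline{f}=\max_{x\in\Delta_n}f(x)$. The regular grid is $\Delta(n,r)=\{x\in\Delta_n: rx\in\mathbb{N}^n\}$ and $f_{\Delta(n,r)}=\min_{x\in\Delta(n,r)}f(x)$. *)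

theory Defs
  imports Complex_Main "HOL-Library.Poly_Mapping"
begin

text \<open>A polynomial maps exponent vectors to coefficients; the variables are indexed by naturals,
  and those of an \<open>n\<close>-variate polynomial are \<open>0, \<dots>, n - 1\<close>.\<close>

type_synonym mpoly_real = "(nat \<Rightarrow>\<^sub>0 nat) \<Rightarrow>\<^sub>0 real"

definition homogeneous_polys :: "nat \<Rightarrow> nat \<Rightarrow> mpoly_real set" where
  "homogeneous_polys n d =
     {p. \<forall>m \<in> Poly_Mapping.keys p.
           Poly_Mapping.keys m \<subseteq> {..<n} \<and>
           (\<Sum>i\<in>Poly_Mapping.keys m. Poly_Mapping.lookup m i) = d}"

definition eval_poly :: "mpoly_real \<Rightarrow> (nat \<Rightarrow> real) \<Rightarrow> real" where
  "eval_poly p x =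
     (\<Sum>m\<in>Poly_Mapping.keys p. Poly_Mapping.lookup p m *
        (\<Prod>i\<in>Poly_Mapping.keys m. x i ^ Poly_Mapping.lookup m i))"

text \<open>Points of \<open>n\<close>-dimensional real space are functions vanishing outside \<open>{..<n}\<close>.\<close>

definition std_simplex :: "nat \<Rightarrow> (nat \<Rightarrow> real) set" where
  "std_simplex n = {x. (\<forall>i<n. 0 \<le> x i) \<and> (\<forall>i\<ge>n. x i = 0) \<and> (\<Sum>i<n. x i) = 1}"

definition regular_grid :: "nat \<Rightarrow> nat \<Rightarrow> (nat \<Rightarrow> real) set" where
  "regular_grid n r = {x \<in> std_simplex n. \<forall>i<n. real r * x i \<in> \<nat>}"

text \<open>The extrema below exist for \<open>n \<ge> 1\<close> and \<open>r \<ge> 1\<close>: the simplex is then nonempty and compact,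
  and the grid nonempty and finite.\<close>

definition simplex_min :: "nat \<Rightarrow> mpoly_real \<Rightarrow> real" where
  "simplex_min n f = (LEAST y. y \<in> eval_poly f ` std_simplex n)"

definition simplex_max :: "nat \<Rightarrow> mpoly_real \<Rightarrow> real" where
  "simplex_max n f = (GREATEST y. y \<in> eval_poly f ` std_simplex n)"

definition grid_min :: "nat \<Rightarrow> nat \<Rightarrow> mpoly_real \<Rightarrow> real" where
  "grid_min n r f = (LEAST y. y \<in> eval_poly f ` regular_grid n r)"

end

theory Submission
  imports Defs
begin

text \<open>The form \<open>\<Sum>i<n. (x i)\<^sup>2\<close> is a counterexample for every \<open>\<epsilon>\<close>, already at \<open>r = 2\<close>, once \<open>n\<close> is
  large. On the simplex it ranges from \<open>1/n\<close> at the barycentre to \<open>1\<close> at the vertices. A point of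
  the grid of denominator \<open>r\<close> cannot spread its mass over more than \<open>r\<close> coordinates, so the minimum
  there stays at \<open>1/r\<close> however large \<open>n\<close> is. The relative error
  \<open>(1/r - 1/n) / (1 - 1/n)\<close> therefore tends to \<open>1/r\<close> as \<open>n\<close> grows with \<open>r\<close> fixed, and for \<open>r \<ge> 2\<close>
  this limit exceeds \<open>1 / r powr (1 + \<epsilon>)\<close>.\<close>

definition sum_squares_poly :: "nat \<Rightarrow> mpoly_real" where
  "sum_squares_poly n = (\<Sum>i<n. Poly_Mapping.single (Poly_Mapping.single i 2) 1)"

lemma inj_single_2: "inj (\<lambda>i::nat. Poly_Mapping.single i (2::nat))"
proof (rule injI)
  fix i j :: nat
  assume "Poly_Mapping.single i (2::nat) = Poly_Mapping.single j 2"
  then have "Poly_Mapping.keys (Poly_Mapping.single i (2::nat)) = Poly_Mapping.keys (Poly_Mapping.single j (2::nat))"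
    by simp
  then show "i = j" by simp
qed

lemma lookup_sum_squares_poly:
  "Poly_Mapping.lookup (sum_squares_poly n) m =
     (if m \<in> (\<lambda>i. Poly_Mapping.single i 2) ` {..<n} then 1 else 0)"
proof -
  have "Poly_Mapping.lookup (sum_squares_poly n) m
      = (\<Sum>i<n. if Poly_Mapping.single i 2 = m then 1 else 0)"
    by (simp add: sum_squares_poly_def lookup_sum lookup_single when_def)
  also have "\<dots> = real (card {i \<in> {..<n}. Poly_Mapping.single i 2 = m})"
    by (simp add: sum.If_cases Int_def)
  also have "\<dots> = (if m \<in> (\<lambda>i. Poly_Mapping.single i 2) ` {..<n} then 1 else 0)"
  proof (cases "m \<in> (\<lambda>i. Poly_Mapping.single i 2) ` {..<n}")
    case True
    then obtain j where j: "j < n" "m = Poly_Mapping.single j 2" by auto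
    then have "{i \<in> {..<n}. Poly_Mapping.single i 2 = m} = {j}"
      using injD[OF inj_single_2] by auto
    with True show ?thesis by simp
  next
    case False
    then have "{i \<in> {..<n}. Poly_Mapping.single i 2 = m} = {}" by auto
    with False show ?thesis by simp
  qed
  finally show ?thesis .
qed

lemma keys_sum_squares_poly:
  "Poly_Mapping.keys (sum_squares_poly n) = (\<lambda>i. Poly_Mapping.single i 2) ` {..<n}"
  by (auto simp: in_keys_iff lookup_sum_squares_poly split: if_splits)

lemma sum_squares_poly_homogeneous: "sum_squares_poly n \<in> homogeneous_polys n 2"
  by (auto simp: homogeneous_polys_def keys_sum_squares_poly)

lemma eval_sum_squares_poly: "eval_poly (sum_squares_poly n) x = (\<Sum>i<n. (x i)\<^sup>2)"
  unfolding eval_poly_def keys_sum_squares_poly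
  by (subst sum.reindex) (auto intro: inj_on_subset[OF inj_single_2] simp: lookup_sum_squares_poly)

text \<open>The average of the first \<open>k\<close> unit vectors: a vertex for \<open>k = 1\<close>, the barycentre for \<open>k = n\<close>,
  and a grid point of denominator \<open>k\<close> in between. It attains each of the three extrema below.\<close>

definition face_barycentre :: "nat \<Rightarrow> nat \<Rightarrow> real" where
  "face_barycentre k = (\<lambda>i. if i < k then 1 / real k else 0)"

lemma sum_face_barycentre:
  assumes "1 \<le> k" "k \<le> n"
  shows "(\<Sum>i<n. face_barycentre k i) = 1"
    and "(\<Sum>i<n. (face_barycentre k i)\<^sup>2) = 1 / real k"
proof -
  have *: "(\<Sum>i<n. if i < k then c else 0) = real k * c" for c :: real
  proof -
    have "{..<n} \<inter> {i. i < k} = {..<k}" using assms by auto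
    then show ?thesis by (simp add: sum.If_cases)
  qed
  show "(\<Sum>i<n. face_barycentre k i) = 1"
    using assms by (simp add: face_barycentre_def *)
  have "(\<Sum>i<n. (face_barycentre k i)\<^sup>2) = (\<Sum>i<n. if i < k then (1 / real k)\<^sup>2 else 0)"
    by (rule sum.cong) (auto simp: face_barycentre_def)
  also have "\<dots> = 1 / real k"
    using assms by (simp only: *) (simp add: power2_eq_square)
  finally show "(\<Sum>i<n. (face_barycentre k i)\<^sup>2) = 1 / real k" .
qed

lemma face_barycentre_in_simplex:
  assumes "1 \<le> k" "k \<le> n"
  shows "face_barycentre k \<in> std_simplex n"
  unfolding std_simplex_def using assms sum_face_barycentre(1)[OF assms]
  by (auto simp: face_barycentre_def)

lemma face_barycentre_in_grid:
  assumes "1 \<le> k" "k \<le> n"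
  shows "face_barycentre k \<in> regular_grid n k"
  unfolding regular_grid_def using face_barycentre_in_simplex[OF assms] assms
  by (auto simp: face_barycentre_def)

text \<open>The lower bound is the Cauchy-Schwarz inequality against the constant vector, that is,
  nonnegativity of \<open>\<Sum>i<n. (x i - 1/n)\<^sup>2\<close>.\<close>

lemma simplex_min_sum_squares:
  assumes "n \<ge> 1"
  shows "simplex_min n (sum_squares_poly n) = 1 / real n"
  unfolding simplex_min_def
proof (rule Least_equality)
  show "1 / real n \<in> eval_poly (sum_squares_poly n) ` std_simplex n"
    using sum_face_barycentre(2)[of n n] face_barycentre_in_simplex[of n n] assms
    by (auto simp: image_iff eval_sum_squares_poly intro!: bexI[of _ "face_barycentre n"])
next
  fix y assume "y \<in> eval_poly (sum_squares_poly n) ` std_simplex n"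
  then obtain x where x: "x \<in> std_simplex n" and y: "y = (\<Sum>i<n. (x i)\<^sup>2)"
    by (auto simp: eval_sum_squares_poly)
  have "0 \<le> (\<Sum>i<n. (x i - 1 / real n)\<^sup>2)" by (simp add: sum_nonneg)
  also have "\<dots> = (\<Sum>i<n. (x i)\<^sup>2) - 2 / real n * (\<Sum>i<n. x i) + real n * (1 / real n)\<^sup>2"
    by (simp add: power2_diff sum.distrib sum_subtractf sum_distrib_left mult_ac
        flip: sum_divide_distrib)
  also have "\<dots> = y - 1 / real n"
    using x y assms by (simp add: std_simplex_def power2_eq_square)
  finally show "1 / real n \<le> y" by simp
qed

lemma simplex_max_sum_squares:
  assumes "n \<ge> 1"
  shows "simplex_max n (sum_squares_poly n) = 1"
  unfolding simplex_max_def
proof (rule Greatest_equality)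
  show "1 \<in> eval_poly (sum_squares_poly n) ` std_simplex n"
    using sum_face_barycentre(2)[of 1 n] face_barycentre_in_simplex[of 1 n] assms
    by (auto simp: image_iff eval_sum_squares_poly intro!: bexI[of _ "face_barycentre 1"])
next
  fix y assume "y \<in> eval_poly (sum_squares_poly n) ` std_simplex n"
  then obtain x where x: "x \<in> std_simplex n" and y: "y = (\<Sum>i<n. (x i)\<^sup>2)"
    by (auto simp: eval_sum_squares_poly)
  have nonneg: "0 \<le> x i" if "i < n" for i using x that by (auto simp: std_simplex_def)
  have sum1: "(\<Sum>i<n. x i) = 1" using x by (auto simp: std_simplex_def)
  have le1: "x i \<le> 1" if "i < n" for i
    using member_le_sum[of i "{..<n}" x] nonneg that sum1 by auto
  have "y \<le> (\<Sum>i<n. x i)"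
    unfolding y
  proof (rule sum_mono)
    fix i assume "i \<in> {..<n}"
    then show "(x i)\<^sup>2 \<le> x i"
      using nonneg[of i] le1[of i] mult_left_le[of "x i" "x i"] by (simp add: power2_eq_square)
  qed
  with sum1 show "y \<le> 1" by simp
qed

text \<open>The lower bound is integrality: a natural number \<open>k\<close> satisfies \<open>k \<le> k\<^sup>2\<close>, and the numerators
  of a grid point add up to \<open>r\<close>, so their squares add up to at least \<open>r\<close>.\<close>

lemma grid_min_sum_squares:
  assumes "1 \<le> r" "r \<le> n"
  shows "grid_min n r (sum_squares_poly n) = 1 / real r"
  unfolding grid_min_def
proof (rule Least_equality)
  show "1 / real r \<in> eval_poly (sum_squares_poly n) ` regular_grid n r"
    using sum_face_barycentre(2)[OF assms] face_barycentre_in_grid[OF assms]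
    by (auto simp: image_iff eval_sum_squares_poly intro!: bexI[of _ "face_barycentre r"])
next
  fix y assume "y \<in> eval_poly (sum_squares_poly n) ` regular_grid n r"
  then obtain x where x: "x \<in> regular_grid n r" and y: "y = (\<Sum>i<n. (x i)\<^sup>2)"
    by (auto simp: eval_sum_squares_poly)
  have sum1: "(\<Sum>i<n. x i) = 1" using x by (auto simp: regular_grid_def std_simplex_def)
  have "real r = (\<Sum>i<n. real r * x i)"
    using sum1 by (simp flip: sum_distrib_left)
  also have "\<dots> \<le> (\<Sum>i<n. (real r * x i)\<^sup>2)"
  proof (rule sum_mono)
    fix i assume "i \<in> {..<n}"
    then obtain k :: nat where k: "real r * x i = real k"
      using x by (auto simp: regular_grid_def elim!: Nats_cases)
    have "k \<le> k\<^sup>2" by (simp add: power2_eq_square)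
    then show "real r * x i \<le> (real r * x i)\<^sup>2"
      unfolding k by (simp flip: of_nat_power)
  qed
  also have "\<dots> = (real r)\<^sup>2 * y"
    by (simp add: y power_mult_distrib sum_distrib_left)
  finally show "1 / real r \<le> y"
    using assms by (simp add: power2_eq_square field_simps)
qed

theorem mainTheorem6:
  shows "\<not> (\<exists>\<epsilon>::real. \<epsilon> > 0 \<and>
    (\<forall>n::nat. n \<ge> 1 \<longrightarrow> (\<forall>f \<in> homogeneous_polys n 2. \<forall>r::nat. r \<ge> 1 \<longrightarrow>
      grid_min n r f - simplex_min n f
        \<le> 1 / (real r powr (1 + \<epsilon>)) * (simplex_max n f - simplex_min n f))))"
proof
  assume "\<exists>\<epsilon>::real. \<epsilon> > 0 \<and>
    (\<forall>n::nat. n \<ge> 1 \<longrightarrow> (\<forall>f \<in> homogeneous_polys n 2. \<forall>r::nat. r \<ge> 1 \<longrightarrow>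
      grid_min n r f - simplex_min n f
        \<le> 1 / (real r powr (1 + \<epsilon>)) * (simplex_max n f - simplex_min n f)))"
  then obtain \<epsilon> :: real where "\<epsilon> > 0" and bound: "\<And>n f r. n \<ge> 1 \<Longrightarrow> f \<in> homogeneous_polys n 2 \<Longrightarrow>
      r \<ge> 1 \<Longrightarrow> grid_min n r f - simplex_min n f
        \<le> 1 / (real r powr (1 + \<epsilon>)) * (simplex_max n f - simplex_min n f)"
    by blast
  define c where "c = 1 / (2::real) powr (1 + \<epsilon>)"
  have "(2::real) powr 1 < 2 powr (1 + \<epsilon>)"
    using \<open>\<epsilon> > 0\<close> by (intro powr_less_mono) auto
  then have c: "0 < c" "c < 1 / 2"
    by (auto simp: c_def field_simps)
  \<comment> \<open>The bound at \<open>r = 2\<close> gives \<open>1/2 - 1/n \<le> c (1 - 1/n) \<le> c\<close>, which \<open>1/n < 1/2 - c\<close> rules out.\<close>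
  obtain m where "inverse (real (Suc m)) < 1 / 2 - c"
    using reals_Archimedean[of "1 / 2 - c"] c by auto
  define n where "n = Suc m"
  have small: "1 / real n < 1 / 2 - c"
    using \<open>inverse (real (Suc m)) < 1 / 2 - c\<close> by (simp add: n_def inverse_eq_divide)
  with c have "1 / real n < 1 / 2" by simp
  then have "2 \<le> n" by (simp add: n_def field_simps)
  then have "1 / 2 - 1 / real n \<le> c * (1 - 1 / real n)"
    using bound[OF _ sum_squares_poly_homogeneous, of n 2]
    by (simp add: simplex_min_sum_squares simplex_max_sum_squares grid_min_sum_squares c_def)
  also have "\<dots> \<le> c"
    using c by (intro mult_left_le) auto
  finally show False using small by simp
qed

end
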